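(* Let $m\geq 2$ be an integer, and let $\Phi$ and $\Phi_i$, $i=1,\dots,m$, be Young functions. Then the following statements are equivalent: (1) There exists a constant $C>0$ such that $$\prod_{i=1}^m \Phi_i^{-1}(t)\leq C\,\Phi^{-1}(t)\quad\text{for every } t\geq 0.$$ (2) There exists a constant $C>0$ such that for all $t_i\geq 0$, $i=1,\dots,m$, $$\Phi\left(\frac{\prod_{i=1}^m t_i}{C}\right)\leq \sum_{i=1}^m \Phi_i(t_i).$$ (3) There exists a constant $M>0$ such that $$\left\Vert \prod_{i=1}^m f_i\right\Vert_{wL_\Phi(\mathbb{R}^n)}\leq M\prod_{i=1}^m \|f_i\|_{wL_{\Phi_i}(\mathbb{R}^n)}$$ for every $f_i\in wL_{\Phi_i}(\mathbb{R}^n)$, $i=1,\dots,m$. (4) For every $f_i\in wL_{\Phi_i}(\mathbb{R}^n)$, $i=1,\dots,m$, one has $\prod_{i=1}^m f_i\in wL_\Phi(\mathbb{R}^n)$.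
   Context: A Young function is a function $\Phi:[0,\infty)\to[0,\infty)$ that is convex and left-continuous, with $\Phi(0)=0$ and $\lim_{t\to\infty}\Phi(t)=\infty$. For a Young function $\Phi$ and $s\geq 0$, define $\Phi^{-1}(s):=\inf\{r\geq 0:\Phi(r)>s\}$. For a Young function $\Phi$, the weak Orlicz space $wL_\Phi(\mathbb{R}^n)$ is the set of measurable functions $f:\mathbb{R}^n\to\mathbb{R}$ such that $$\|f\|_{wL_\Phi(\mathbb{R}^n)}:=\inf\left\{b>0:\sup_{t>0}\Phi(t)\left|\left\{x\in\mathbb{R}^n:\frac{|f(x)|}{b}>t\right\}\right|\leq 1\right\}<\infty,$$ where $|E|$ denotes the Lebesgue measure of $E$ (with the usual measure-theoretic convention $0\cdot\infty=0$, and $\inf\emptyset=\infty$). *)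

theory Defs
  imports "HOL-Analysis.Analysis"
begin

text \<open>
  A function on the half-line is a total function on the reals of which only the values at
  nonnegative arguments are ever used.
\<close>

definition young_function :: "(real \<Rightarrow> real) \<Rightarrow> bool" where
  "young_function \<Phi> \<longleftrightarrow>
     (\<forall>t\<ge>0. 0 \<le> \<Phi> t) \<and>
     convex_on {0..} \<Phi> \<and>
     (\<forall>t>0. continuous (at_left t) \<Phi>) \<and>
     \<Phi> 0 = 0 \<and>
     filterlim \<Phi> at_top at_top"

definition young_inverse :: "(real \<Rightarrow> real) \<Rightarrow> real \<Rightarrow> real" where
  "young_inverse \<Phi> s = Inf {r. 0 \<le> r \<and> s < \<Phi> r}"

text \<open>
  In \<^typ>\<open>ennreal\<close> one has \<open>0 * \<infinity> = 0\<close> and \<open>Inf {} = \<infinity>\<close>, as the definition of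
  the quasi-norm requires.
\<close>

definition weak_orlicz_norm :: "(real \<Rightarrow> real) \<Rightarrow> ('a::euclidean_space \<Rightarrow> real) \<Rightarrow> ennreal" where
  "weak_orlicz_norm \<Phi> f =
     Inf {ennreal b | b. 0 < b \<and>
       (SUP t\<in>{0<..}. ennreal (\<Phi> t) * emeasure lebesgue {x. t < \<bar>f x\<bar> / b}) \<le> 1}"

definition weak_orlicz :: "(real \<Rightarrow> real) \<Rightarrow> ('a::euclidean_space \<Rightarrow> real) set" where
  "weak_orlicz \<Phi> = {f \<in> borel_measurable lebesgue. weak_orlicz_norm \<Phi> f < \<infinity>}"

end

theory Submission
  imports Defs
begin

text \<open>
  The implication from the inverse inequality to the weak Hoelder inequality splits the set where
  the product is large: a product exceeding \<open>\<Prod> a\<^sub>i\<close> has some factor exceeding \<open>a\<^sub>i\<close>. Conversely,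
  with \<open>V x\<close> the volume of the ball of radius \<open>norm x\<close>, the functions \<open>\<Phi>\<^sub>i\<^sup>-\<^sup>1 (1 / V x)\<close> lie in the
  unit balls of the weak spaces and are all extremal at once: membership of their single product in
  \<open>wL\<^sub>\<Phi>\<close> already gives the inverse inequality, with no uniform boundedness argument.
\<close>

section \<open>Young functions and their inverses\<close>

lemma young_nonneg: "young_function \<Phi> \<Longrightarrow> 0 \<le> t \<Longrightarrow> 0 \<le> \<Phi> t"
  by (simp add: young_function_def)

text \<open>Convexity on the segment from 0 to \<open>x\<close>, together with
  \<open>\<Phi> 0 = 0\<close>. This is the form in which convexity enters all later
  arguments.\<close>

lemma young_scale:
  assumes "young_function \<Phi>" "0 \<le> c" "c \<le> 1" "0 \<le> x"
  shows "\<Phi> (c * x) \<le> c * \<Phi> x"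
proof -
  have "convex_on {0..} \<Phi>" "\<Phi> 0 = 0"
    using assms by (auto simp: young_function_def)
  then show ?thesis
    using convex_onD[of "{0..}" \<Phi> c 0 x] assms by simp
qed

text \<open>Monotonicity is not part of the definition; it follows from scaling \<open>y\<close>
  down to \<open>x\<close> by the factor \<open>x / y\<close>.\<close>

lemma young_mono:
  assumes "young_function \<Phi>" "0 \<le> x" "x \<le> y"
  shows "\<Phi> x \<le> \<Phi> y"
proof (cases "y = 0")
  case False
  then have "\<Phi> ((x / y) * y) \<le> (x / y) * \<Phi> y"
    using assms by (intro young_scale[OF assms(1)]) auto
  also have "\<dots> \<le> 1 * \<Phi> y"
    using assms False young_nonneg[OF assms(1), of y] by (intro mult_right_mono) auto
  finally show ?thesis using False by simp
qed (use assms in auto)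

text \<open>Makes the set in \<open>young_inverse\<close> nonempty, so that the real
  \<open>Inf\<close> there is a genuine infimum.\<close>

lemma young_unbounded:
  assumes "young_function \<Phi>"
  shows "\<exists>r\<ge>0. s < \<Phi> r"
proof -
  have "filterlim \<Phi> at_top at_top"
    using assms by (simp add: young_function_def)
  then have "eventually (\<lambda>r. s < \<Phi> r) at_top"
    by (simp add: filterlim_at_top_dense)
  then have "eventually (\<lambda>r. s < \<Phi> r \<and> 0 \<le> r) at_top"
    using eventually_ge_at_top by (rule eventually_conj)
  then show ?thesis
    using eventually_happens'[OF trivial_limit_at_top_linorder] by blast
qed

lemma young_inverse_le: "0 \<le> r \<Longrightarrow> s < \<Phi> r \<Longrightarrow> young_inverse \<Phi> s \<le> r"
  unfolding young_inverse_def by (rule cInf_lower) auto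

lemma young_inverse_greatest:
  assumes "young_function \<Phi>" "\<And>r. 0 \<le> r \<Longrightarrow> s < \<Phi> r \<Longrightarrow> a \<le> r"
  shows "a \<le> young_inverse \<Phi> s"
  unfolding young_inverse_def
  using young_unbounded[OF assms(1), of s] assms(2) by (intro cInf_greatest) auto

lemma young_inverse_nonneg: "young_function \<Phi> \<Longrightarrow> 0 \<le> young_inverse \<Phi> s"
  by (erule young_inverse_greatest)

lemma young_inverse_mono: "young_function \<Phi> \<Longrightarrow> mono (young_inverse \<Phi>)"
  by (intro monoI young_inverse_greatest young_inverse_le) simp_all

text \<open>A competitor \<open>r'\<close> below \<open>r\<close> would satisfy
  \<open>\<Phi> r' \<le> \<Phi> r \<le> s\<close> by monotonicity. Together with
  \<open>young_at_inverse_le\<close> this gives, for nonnegative \<open>r\<close> and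
  \<open>s\<close>, the Galois connection between \<Phi> and its generalized inverse.\<close>

lemma le_young_inverse:
  assumes "young_function \<Phi>" "\<Phi> r \<le> s"
  shows "r \<le> young_inverse \<Phi> s"
proof (rule young_inverse_greatest[OF assms(1)])
  fix r' assume "0 \<le> r'" "s < \<Phi> r'"
  then show "r \<le> r'"
    using young_mono[OF assms(1), of r' r] assms(2) by (cases "r \<le> r'") auto
qed

lemma young_inverse_less:
  assumes "young_function \<Phi>" "young_inverse \<Phi> s < r"
  shows "s < \<Phi> r"
  using le_young_inverse[OF assms(1), of r s] assms(2) by linarith

lemma young_inverse_pos:
  assumes "young_function \<Phi>" "0 < s"
  shows "0 < young_inverse \<Phi> s"
proof -
  \<comment> \<open>By scaling, \<open>\<Phi> c \<le> c * \<Phi> 1\<close>, so this choice gives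
    \<open>\<Phi> c \<le> s\<close>. The summand 1 keeps the denominator positive when
    \<open>\<Phi> 1 = 0\<close>.\<close>
  define c where "c = min 1 (s / (\<Phi> 1 + 1))"
  have pos: "0 \<le> \<Phi> 1" using young_nonneg[OF assms(1)] by simp
  have c: "0 < c" "c \<le> 1" "c \<le> s / (\<Phi> 1 + 1)"
    using pos assms by (auto simp: c_def)
  have "\<Phi> (c * 1) \<le> c * \<Phi> 1"
    using c by (intro young_scale[OF assms(1)]) auto
  also have "\<dots> \<le> c * (\<Phi> 1 + 1)"
    using c by simp
  also have "\<dots> \<le> s"
    using c(3) pos by (simp add: field_simps)
  finally have "c \<le> young_inverse \<Phi> s"
    using le_young_inverse[OF assms(1)] by simp
  with c show ?thesis by simp
qed

text \<open>Here left-continuity is decisive: if \<Phi> exceeded \<open>s\<close> at the infimum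
  \<open>a\<close>, then \<open>a\<close> would be positive and \<Phi> would exceed \<open>s\<close>
  already at some point to the left of \<open>a\<close>.\<close>

lemma young_at_inverse_le:
  assumes "young_function \<Phi>" "0 \<le> s"
  shows "\<Phi> (young_inverse \<Phi> s) \<le> s"
proof (rule ccontr)
  define a where "a = young_inverse \<Phi> s"
  assume "\<not> \<Phi> (young_inverse \<Phi> s) \<le> s"
  then have gt: "s < \<Phi> a" by (simp add: a_def)
  have "a \<noteq> 0"
    using gt assms by (auto simp: young_function_def)
  then have a: "0 < a"
    using young_inverse_nonneg[OF assms(1), of s] by (simp add: a_def)
  then have "(\<Phi> \<longlongrightarrow> \<Phi> a) (at_left a)"
    using assms by (auto simp: young_function_def continuous_within)
  then have "eventually (\<lambda>r. s < \<Phi> r) (at_left a)"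
    using gt by (rule order_tendstoD)
  moreover have "eventually (\<lambda>r. r \<in> {0<..<a}) (at_left a)"
    using a by (rule eventually_at_left_real)
  ultimately have "eventually (\<lambda>r. s < \<Phi> r \<and> r \<in> {0<..<a}) (at_left a)"
    by (rule eventually_conj)
  then have "\<exists>r. s < \<Phi> r \<and> r \<in> {0<..<a}"
    by (rule eventually_happens'[OF trivial_limit_at_left_real])
  then obtain r where "s < \<Phi> r" "0 < r" "r < a"
    by auto
  then show False
    using young_inverse_le[of r s \<Phi>] by (simp add: a_def)
qed

text \<open>For \<open>r > k * t\<close>, convexity gives
  \<open>\<Phi> r \<ge> (r / t) * \<Phi> t > k * \<Phi> t\<close>, so \<open>r\<close> competes in
  the infimum; then \<open>r\<close> decreases to \<open>k * t\<close>. The lemma later absorbs the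
  number of factors produced by a union bound.\<close>

lemma young_inverse_scale:
  assumes "young_function \<Phi>" "1 \<le> k" "0 \<le> t" "0 < \<Phi> t"
  shows "young_inverse \<Phi> (k * \<Phi> t) \<le> k * t"
proof (rule dense_ge)
  fix r assume r: "k * t < r"
  have "t \<noteq> 0" using assms by (auto simp: young_function_def)
  then have t: "0 < t" using assms by simp
  then have tr: "t \<le> r" using r assms(2,3) mult_right_mono[of 1 k t] by linarith
  have "\<Phi> ((t / r) * r) \<le> (t / r) * \<Phi> r"
    using t tr by (intro young_scale[OF assms(1)]) auto
  then have "r * \<Phi> t \<le> t * \<Phi> r"
    using t tr by (simp add: field_simps)
  moreover have "(k * t) * \<Phi> t < r * \<Phi> t"
    using r assms by (intro mult_strict_right_mono)
  ultimately have "t * (k * \<Phi> t) < t * \<Phi> r"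
    by (simp add: algebra_simps)
  then have "k * \<Phi> t < \<Phi> r" using t by simp
  then show "young_inverse \<Phi> (k * \<Phi> t) \<le> r"
    using t tr by (intro young_inverse_le) auto
qed

section \<open>The weak quasi-norm\<close>

lemma weak_orlicz_norm_le:
  assumes "0 < b" "\<And>t. 0 < t \<Longrightarrow> ennreal (\<Phi> t) * emeasure lebesgue {x. t < \<bar>f x\<bar> / b} \<le> 1"
  shows "weak_orlicz_norm \<Phi> f \<le> ennreal b"
proof -
  have "(SUP t\<in>{0<..}. ennreal (\<Phi> t) * emeasure lebesgue {x. t < \<bar>f x\<bar> / b}) \<le> 1"
    using assms(2) by (intro SUP_least) simp
  with assms(1) show ?thesis
    unfolding weak_orlicz_norm_def by (intro Inf_lower) blast
qed

lemma sets_lebesgue_abs_greater: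
  fixes f :: "'a::euclidean_space \<Rightarrow> real"
  assumes "f \<in> borel_measurable lebesgue"
  shows "{x. t < \<bar>f x\<bar> / b} \<in> sets lebesgue"
proof -
  have "{x \<in> space lebesgue. t < \<bar>f x\<bar> / b} \<in> sets lebesgue"
    using assms by measurable
  then show ?thesis by simp
qed

text \<open>A norm strictly below \<open>b\<close> provides an admissible \<open>b' < b\<close>, and
  the superlevel sets shrink when the divisor grows. Strictness avoids the question whether the
  infimum is attained.\<close>

lemma weak_orlicz_norm_less:
  fixes f :: "'a::euclidean_space \<Rightarrow> real"
  assumes f: "f \<in> borel_measurable lebesgue"
    and less: "weak_orlicz_norm \<Phi> f < ennreal b" and "0 < t"
  shows "ennreal (\<Phi> t) * emeasure lebesgue {x. t < \<bar>f x\<bar> / b} \<le> 1"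
proof -
  obtain b' where b': "0 < b'" "ennreal b' < ennreal b"
    and S: "(SUP t\<in>{0<..}. ennreal (\<Phi> t) * emeasure lebesgue {x. t < \<bar>f x\<bar> / b'}) \<le> 1"
    using less unfolding weak_orlicz_norm_def Inf_less_iff by auto
  then have "b' < b" by (simp add: ennreal_less_iff)
  then have sub: "t < \<bar>f x\<bar> / b'" if "t < \<bar>f x\<bar> / b" for x
    using that b'(1) divide_left_mono[of b' b "\<bar>f x\<bar>"] by simp
  have meas: "{x. t < \<bar>f x\<bar> / b'} \<in> sets lebesgue"
    by (rule sets_lebesgue_abs_greater[OF f])
  have "emeasure lebesgue {x. t < \<bar>f x\<bar> / b} \<le> emeasure lebesgue {x. t < \<bar>f x\<bar> / b'}"
    by (rule emeasure_mono) (use sub meas in auto)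
  then have "ennreal (\<Phi> t) * emeasure lebesgue {x. t < \<bar>f x\<bar> / b}
      \<le> ennreal (\<Phi> t) * emeasure lebesgue {x. t < \<bar>f x\<bar> / b'}"
    by (rule mult_left_mono) simp
  also have "\<dots> \<le> 1"
    using S \<open>0 < t\<close> by (auto simp: SUP_le_iff)
  finally show ?thesis .
qed

text \<open>Turns the weak-type condition into an upper bound for the measure of a superlevel set.
  For infinite \<open>z\<close> both sides are false.\<close>

lemma ennreal_mult_le_1_iff:
  assumes "0 < c"
  shows "ennreal c * z \<le> 1 \<longleftrightarrow> z \<le> ennreal (1 / c)"
proof (cases z)
  case (real r)
  then show ?thesis
    using assms by (simp add: ennreal_mult[symmetric] field_simps)
next
  case top
  then show ?thesis using assms by (simp add: ennreal_mult_top top_unique)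
qed

section \<open>The weak Hoelder inequality\<close>

text \<open>All inverses are evaluated at the same point, the sum \<open>T\<close> on the right.
  Each \<open>\<Phi>s i (t i)\<close> is at most \<open>T\<close>, hence each \<open>t i\<close> is
  at most the inverse of \<open>\<Phi>s i\<close> at \<open>T\<close>, and \<Phi> maps its own
  inverse at \<open>T\<close> below \<open>T\<close>.\<close>

lemma young_inequality_of_inverse:
  assumes \<Phi>: "young_function \<Phi>" and \<Phi>s: "\<And>i. i \<in> I \<Longrightarrow> young_function (\<Phi>s i)"
    and "finite I" "0 < C"
    and le: "\<And>t. 0 \<le> t \<Longrightarrow> (\<Prod>i\<in>I. young_inverse (\<Phi>s i) t) \<le> C * young_inverse \<Phi> t"
    and t: "\<And>i. i \<in> I \<Longrightarrow> 0 \<le> t i"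
  shows "\<Phi> ((\<Prod>i\<in>I. t i) / C) \<le> (\<Sum>i\<in>I. \<Phi>s i (t i))"
proof -
  define T where "T = (\<Sum>i\<in>I. \<Phi>s i (t i))"
  have nn: "0 \<le> \<Phi>s i (t i)" if "i \<in> I" for i
    using that young_nonneg[OF \<Phi>s[OF that]] t by simp
  then have T: "0 \<le> T" by (simp add: T_def sum_nonneg)
  have "(\<Prod>i\<in>I. t i) \<le> (\<Prod>i\<in>I. young_inverse (\<Phi>s i) T)"
  proof (rule prod_mono)
    fix i assume i: "i \<in> I"
    then have "\<Phi>s i (t i) \<le> T"
      unfolding T_def using nn \<open>finite I\<close> by (intro member_le_sum) auto
    then show "0 \<le> t i \<and> t i \<le> young_inverse (\<Phi>s i) T"
      using i t \<Phi>s by (auto intro: le_young_inverse)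
  qed
  also have "\<dots> \<le> C * young_inverse \<Phi> T" using le T by simp
  finally have "(\<Prod>i\<in>I. t i) / C \<le> young_inverse \<Phi> T"
    using \<open>0 < C\<close> by (simp add: field_simps)
  then have "\<Phi> ((\<Prod>i\<in>I. t i) / C) \<le> \<Phi> (young_inverse \<Phi> T)"
    using t \<open>0 < C\<close>
    by (intro young_mono[OF \<Phi>] divide_nonneg_pos prod_nonneg) auto
  also have "\<dots> \<le> T" by (rule young_at_inverse_le[OF \<Phi> T])
  finally show ?thesis by (simp add: T_def)
qed

text \<open>Inserting the inverses at \<open>s\<close> for the \<open>t i\<close> bounds \<Phi> by
  \<open>card I * s\<close>. Scaling the argument by \<open>1 / card I\<close> removes that factor
  and moves it into the constant.\<close>

lemma inverse_of_young_inequality: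
  assumes \<Phi>: "young_function \<Phi>" and \<Phi>s: "\<And>i. i \<in> I \<Longrightarrow> young_function (\<Phi>s i)"
    and I: "finite I" "I \<noteq> {}" and "0 < C"
    and le: "\<And>t. (\<And>i. i \<in> I \<Longrightarrow> 0 \<le> t i) \<Longrightarrow> \<Phi> ((\<Prod>i\<in>I. t i) / C) \<le> (\<Sum>i\<in>I. \<Phi>s i (t i))"
    and "0 \<le> s"
  shows "(\<Prod>i\<in>I. young_inverse (\<Phi>s i) s) \<le> C * card I * young_inverse \<Phi> s"
proof -
  define P where "P = (\<Prod>i\<in>I. young_inverse (\<Phi>s i) s)"
  have nn: "0 \<le> young_inverse (\<Phi>s i) s" if "i \<in> I" for i
    using that by (rule young_inverse_nonneg[OF \<Phi>s])
  then have P: "0 \<le> P"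
    unfolding P_def by (rule prod_nonneg)
  have k: "1 \<le> real (card I)"
    using I by (simp add: Suc_le_eq card_gt_0_iff)
  have "\<Phi> (P / C) \<le> (\<Sum>i\<in>I. \<Phi>s i (young_inverse (\<Phi>s i) s))"
    unfolding P_def using nn by (rule le)
  also have "\<dots> \<le> (\<Sum>i\<in>I. s)"
    using young_at_inverse_le[OF \<Phi>s \<open>0 \<le> s\<close>] by (rule sum_mono)
  finally have *: "\<Phi> (P / C) \<le> card I * s" by simp
  have "\<Phi> (1 / card I * (P / C)) \<le> 1 / card I * \<Phi> (P / C)"
    using k P \<open>0 < C\<close> by (intro young_scale[OF \<Phi>]) auto
  also have "\<dots> \<le> s"
    using * k by (simp add: field_simps)
  finally have "1 / card I * (P / C) \<le> young_inverse \<Phi> s"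
    by (rule le_young_inverse[OF \<Phi>])
  then show ?thesis
    using k \<open>0 < C\<close> by (simp add: P_def field_simps)
qed

text \<open>The normalized case: every \<open>g i\<close> satisfies the weak-type condition with
  divisor 1. Thresholds \<open>a i\<close> are chosen so that each single superlevel set has measure
  at most \<open>1 / (card I * \<Phi> t)\<close>, and a union bound adds these up. If
  \<open>\<Phi> t = 0\<close>, the left-hand side is 0 even for a set of infinite measure.\<close>

lemma weak_type_product:
  fixes g :: "'i \<Rightarrow> 'a::euclidean_space \<Rightarrow> real"
  assumes \<Phi>: "young_function \<Phi>" and \<Phi>s: "\<And>i. i \<in> I \<Longrightarrow> young_function (\<Phi>s i)"
    and I: "finite I" "I \<noteq> {}" and "0 < C"
    and le: "\<And>t. 0 \<le> t \<Longrightarrow> (\<Prod>i\<in>I. young_inverse (\<Phi>s i) t) \<le> C * young_inverse \<Phi> t"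
    and g: "\<And>i. i \<in> I \<Longrightarrow> g i \<in> borel_measurable lebesgue"
    and weak: "\<And>i t. i \<in> I \<Longrightarrow> 0 < t \<Longrightarrow>
      ennreal (\<Phi>s i t) * emeasure lebesgue {x. t < \<bar>g i x\<bar>} \<le> 1"
    and "0 < t"
  shows "ennreal (\<Phi> t) *
    emeasure lebesgue {x. 2 ^ card I * C * card I * t < \<bar>\<Prod>i\<in>I. g i x\<bar>} \<le> 1"
proof (cases "\<Phi> t = 0")
  case False
  then have pos: "0 < \<Phi> t"
    using young_nonneg[OF \<Phi>, of t] \<open>0 < t\<close> by simp
  define k where "k = real (card I)"
  have k: "1 \<le> k"
    using I by (simp add: k_def Suc_le_eq card_gt_0_iff)
  \<comment> \<open>With this level, \<open>card I\<close> sets of measure at most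
    \<open>1 / u\<close> have total measure at most \<open>1 / \<Phi> t\<close>.\<close>
  define u where "u = k * \<Phi> t"
  have u: "0 < u" using k pos by (simp add: u_def)
  \<comment> \<open>The factor 2 forces \<open>\<Phi>s i (a i) \<ge> u\<close> without appealing to right-continuity.\<close>
  define a where "a i = 2 * young_inverse (\<Phi>s i) u" for i
  have a: "0 < a i" "u \<le> \<Phi>s i (a i)" if "i \<in> I" for i
  proof -
    have "0 < young_inverse (\<Phi>s i) u"
      using that \<Phi>s u by (intro young_inverse_pos)
    then show "0 < a i" "u \<le> \<Phi>s i (a i)"
      using young_inverse_less[OF \<Phi>s[OF that], of u "a i"] by (auto simp: a_def)
  qed
  have "(\<Prod>i\<in>I. a i) = 2 ^ card I * (\<Prod>i\<in>I. young_inverse (\<Phi>s i) u)"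
    by (simp add: a_def prod.distrib)
  also have "\<dots> \<le> 2 ^ card I * (C * young_inverse \<Phi> u)"
    using le u by (intro mult_left_mono) auto
  also have "\<dots> \<le> 2 ^ card I * (C * (k * t))"
    unfolding u_def using young_inverse_scale[OF \<Phi> k _ pos] \<open>0 < t\<close> \<open>0 < C\<close>
    by (intro mult_left_mono) auto
  finally have prod_a: "(\<Prod>i\<in>I. a i) \<le> 2 ^ card I * C * k * t"
    by (simp add: mult.assoc)
  have "{x. 2 ^ card I * C * k * t < \<bar>\<Prod>i\<in>I. g i x\<bar>} \<subseteq> (\<Union>i\<in>I. {x. a i < \<bar>g i x\<bar>})"
  proof
    fix x assume "x \<in> {x. 2 ^ card I * C * k * t < \<bar>\<Prod>i\<in>I. g i x\<bar>}"
    then have "(\<Prod>i\<in>I. a i) < (\<Prod>i\<in>I. \<bar>g i x\<bar>)"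
      using prod_a by (simp add: abs_prod)
    then have "\<not> (\<forall>i\<in>I. \<bar>g i x\<bar> \<le> a i)"
      using prod_mono[of I "\<lambda>i. \<bar>g i x\<bar>" a] by (meson abs_ge_zero not_le)
    then show "x \<in> (\<Union>i\<in>I. {x. a i < \<bar>g i x\<bar>})" by (simp add: not_le)
  qed
  moreover have meas: "{x. a i < \<bar>g i x\<bar>} \<in> sets lebesgue" if "i \<in> I" for i
    using sets_lebesgue_abs_greater[OF g[OF that], of "a i" 1] by simp
  ultimately have "emeasure lebesgue {x. 2 ^ card I * C * k * t < \<bar>\<Prod>i\<in>I. g i x\<bar>}
      \<le> emeasure lebesgue (\<Union>i\<in>I. {x. a i < \<bar>g i x\<bar>})"
    using I(1) by (intro emeasure_mono sets.finite_UN) auto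
  also have "\<dots> \<le> (\<Sum>i\<in>I. emeasure lebesgue {x. a i < \<bar>g i x\<bar>})"
    using I(1) meas by (intro emeasure_subadditive_finite) auto
  also have "\<dots> \<le> (\<Sum>i\<in>I. ennreal (1 / u))"
  proof (rule sum_mono)
    fix i assume i: "i \<in> I"
    have "ennreal u * emeasure lebesgue {x. a i < \<bar>g i x\<bar>}
        \<le> ennreal (\<Phi>s i (a i)) * emeasure lebesgue {x. a i < \<bar>g i x\<bar>}"
      using a(2)[OF i] by (intro mult_right_mono ennreal_leI) auto
    also have "\<dots> \<le> 1" using i a by (intro weak)
    finally show "emeasure lebesgue {x. a i < \<bar>g i x\<bar>} \<le> ennreal (1 / u)"
      using ennreal_mult_le_1_iff[OF u] by simp
  qed
  also have "\<dots> = ennreal (k * (1 / u))"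
    using u by (simp add: k_def ennreal_of_nat_eq_real_of_nat ennreal_mult[symmetric])
  also have "k * (1 / u) = 1 / \<Phi> t"
    using k by (simp add: u_def)
  finally show ?thesis
    using ennreal_mult_le_1_iff[OF pos] by (simp add: k_def)
qed simp

text \<open>Homogeneity reduces the claim to \<open>weak_type_product\<close>: each factor is
  divided by a number slightly above its norm, and the excess then tends to 0.\<close>

lemma weak_orlicz_norm_prod_le:
  fixes f :: "'i \<Rightarrow> 'a::euclidean_space \<Rightarrow> real"
  assumes \<Phi>: "young_function \<Phi>" and \<Phi>s: "\<And>i. i \<in> I \<Longrightarrow> young_function (\<Phi>s i)"
    and I: "finite I" "I \<noteq> {}" and C: "0 < C"
    and le: "\<And>t. 0 \<le> t \<Longrightarrow> (\<Prod>i\<in>I. young_inverse (\<Phi>s i) t) \<le> C * young_inverse \<Phi> t"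
    and f: "\<And>i. i \<in> I \<Longrightarrow> f i \<in> weak_orlicz (\<Phi>s i)"
  shows "weak_orlicz_norm \<Phi> (\<lambda>x. \<Prod>i\<in>I. f i x)
    \<le> ennreal (2 ^ card I * C * card I) * (\<Prod>i\<in>I. weak_orlicz_norm (\<Phi>s i) (f i))"
proof -
  define M where "M = 2 ^ card I * C * card I"
  have M: "0 < M"
    using I C by (simp add: M_def card_gt_0_iff)
  define N where "N i = enn2real (weak_orlicz_norm (\<Phi>s i) (f i))" for i
  have N: "weak_orlicz_norm (\<Phi>s i) (f i) = ennreal (N i)" "0 \<le> N i"
    and meas: "f i \<in> borel_measurable lebesgue" if "i \<in> I" for i
    using f[OF that] by (auto simp: N_def weak_orlicz_def less_top)
  \<comment> \<open>Adding \<open>e\<close> makes the divisors positive even where a norm vanishes,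
    and strictly larger than the norm, as \<open>weak_orlicz_norm_less\<close> requires.\<close>
  have bound: "weak_orlicz_norm \<Phi> (\<lambda>x. \<Prod>i\<in>I. f i x) \<le> ennreal (M * (\<Prod>i\<in>I. N i + e))"
    if e: "0 < e" for e
  proof (rule weak_orlicz_norm_le)
    have P: "0 < (\<Prod>i\<in>I. N i + e)"
      using N e by (intro prod_pos) (simp add: add_nonneg_pos)
    then show "0 < M * (\<Prod>i\<in>I. N i + e)"
      using M by simp
    fix t :: real assume t: "0 < t"
    have "ennreal (\<Phi> t) * emeasure lebesgue {x. M * t < \<bar>\<Prod>i\<in>I. f i x / (N i + e)\<bar>} \<le> 1"
      unfolding M_def
    proof (rule weak_type_product[OF \<Phi> \<Phi>s I C le _ _ t])
      fix i s assume i: "i \<in> I"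
      show "(\<lambda>x. f i x / (N i + e)) \<in> borel_measurable lebesgue"
        using meas[OF i] by measurable
      assume s: "0 < (s::real)"
      have "weak_orlicz_norm (\<Phi>s i) (f i) < ennreal (N i + e)"
        using N[OF i] e by (simp add: ennreal_less_iff)
      from weak_orlicz_norm_less[OF meas[OF i] this s]
      show "ennreal (\<Phi>s i s) * emeasure lebesgue {x. s < \<bar>f i x / (N i + e)\<bar>} \<le> 1"
        using N(2)[OF i] e by (simp add: abs_divide)
    qed
    moreover have "M * t < \<bar>\<Prod>i\<in>I. f i x / (N i + e)\<bar> \<longleftrightarrow>
        t < \<bar>\<Prod>i\<in>I. f i x\<bar> / (M * (\<Prod>i\<in>I. N i + e))" for x
      using M P by (simp add: prod_dividef abs_divide field_simps)
    ultimately show "ennreal (\<Phi> t) *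
        emeasure lebesgue {x. t < \<bar>\<Prod>i\<in>I. f i x\<bar> / (M * (\<Prod>i\<in>I. N i + e))} \<le> 1"
      by simp
  qed
  \<comment> \<open>The finite product is continuous in \<open>e\<close>, so the bound survives the
    limit from the right at 0.\<close>
  have "((\<lambda>e. M * (\<Prod>i\<in>I. N i + e)) \<longlongrightarrow> M * (\<Prod>i\<in>I. N i + 0)) (at_right 0)"
    by (intro tendsto_intros)
  then have "((\<lambda>e. ennreal (M * (\<Prod>i\<in>I. N i + e))) \<longlongrightarrow> ennreal (M * (\<Prod>i\<in>I. N i + 0))) (at_right 0)"
    by (rule tendsto_ennrealI)
  moreover have "eventually (\<lambda>e. weak_orlicz_norm \<Phi> (\<lambda>x. \<Prod>i\<in>I. f i x)
      \<le> ennreal (M * (\<Prod>i\<in>I. N i + e))) (at_right 0)"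
    using bound by (auto simp: eventually_at_filter)
  ultimately have "weak_orlicz_norm \<Phi> (\<lambda>x. \<Prod>i\<in>I. f i x) \<le> ennreal (M * (\<Prod>i\<in>I. N i + 0))"
    by (rule tendsto_lowerbound) simp
  also have "\<dots> = ennreal M * (\<Prod>i\<in>I. weak_orlicz_norm (\<Phi>s i) (f i))"
    using M N by (simp add: ennreal_mult prod_nonneg prod_ennreal[symmetric])
  finally show ?thesis by (simp add: M_def)
qed

lemma prod_mem_weak_orlicz:
  fixes f :: "'i \<Rightarrow> 'a::euclidean_space \<Rightarrow> real"
  assumes f: "\<And>i. i \<in> I \<Longrightarrow> f i \<in> weak_orlicz (\<Phi>s i)"
    and le: "weak_orlicz_norm \<Phi> (\<lambda>x. \<Prod>i\<in>I. f i x)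
      \<le> ennreal M * (\<Prod>i\<in>I. weak_orlicz_norm (\<Phi>s i) (f i))"
  shows "(\<lambda>x. \<Prod>i\<in>I. f i x) \<in> weak_orlicz \<Phi>"
proof -
  have "(\<Prod>i\<in>I. weak_orlicz_norm (\<Phi>s i) (f i)) \<noteq> top"
    using f by (auto simp: weak_orlicz_def ennreal_prod_eq_top less_top)
  then have "ennreal M * (\<Prod>i\<in>I. weak_orlicz_norm (\<Phi>s i) (f i)) < top"
    by (simp add: ennreal_mult_less_top less_top)
  with le have "weak_orlicz_norm \<Phi> (\<lambda>x. \<Prod>i\<in>I. f i x) < top"
    by (rule le_less_trans)
  moreover have "(\<lambda>x. \<Prod>i\<in>I. f i x) \<in> borel_measurable lebesgue"
    using f by (intro borel_measurable_prod) (simp add: weak_orlicz_def)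
  ultimately show ?thesis by (simp add: weak_orlicz_def)
qed

section \<open>Extremal functions\<close>

definition ball_vol :: "'a::euclidean_space \<Rightarrow> real" where
  "ball_vol x = unit_ball_vol (DIM('a)) * norm x ^ DIM('a)"

lemma ball_vol_nonneg: "0 \<le> ball_vol x"
  by (simp add: ball_vol_def)

text \<open>The sublevel sets of \<open>ball_vol\<close> are centred balls whose measure equals the
  level. Thus \<open>ball_vol\<close> serves, in every dimension, as a radial coordinate carrying
  Lebesgue measure to Lebesgue measure on the half-line.\<close>

lemma emeasure_ball_vol_le:
  assumes "0 \<le> s"
  shows "{x::'a::euclidean_space. ball_vol x \<le> s} \<in> sets lebesgue"
    and "emeasure lebesgue {x::'a. ball_vol x \<le> s} = ennreal s"
proof -
  define n where "n = DIM('a)"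
  define c where "c = unit_ball_vol (real n)"
  have n: "0 < n" by (simp add: n_def)
  have c: "0 < c" by (simp add: c_def)
  \<comment> \<open>The radius at which the ball has volume \<open>s\<close>, that is
    \<open>c * r ^ n = s\<close>.\<close>
  define r where "r = root n (s / c)"
  have r: "0 \<le> r" "r ^ n = s / c"
    using n c assms by (auto simp: r_def real_root_pow_pos2)
  have "ball_vol x \<le> s \<longleftrightarrow> norm x \<le> r" for x :: 'a
  proof -
    have "ball_vol x \<le> s \<longleftrightarrow> norm x ^ n \<le> r ^ n"
      using c by (simp add: ball_vol_def r(2) field_simps flip: n_def c_def)
    also have "\<dots> \<longleftrightarrow> norm x \<le> r"
      using n r(1) by (simp add: power_mono_iff)
    finally show ?thesis .
  qed
  then have eq: "{x::'a. ball_vol x \<le> s} = cball 0 r"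
    by (intro set_eqI) (simp add: mem_cball_0)
  then show "{x::'a. ball_vol x \<le> s} \<in> sets lebesgue" by simp
  have "emeasure lebesgue (cball (0::'a) r) = ennreal (c * r ^ n)"
    using emeasure_cball[of r "0::'a"] r(1) by (simp add: c_def n_def)
  then show "emeasure lebesgue {x::'a. ball_vol x \<le> s} = ennreal s"
    using c by (simp add: eq r(2))
qed

text \<open>A value above \<open>t\<close> forces \<open>\<Phi> t \<le> 1 / ball_vol x\<close>,
  which confines \<open>x\<close> to a ball of measure \<open>1 / \<Phi> t\<close>. So the divisor 1
  is admissible.\<close>

lemma young_inverse_ball_vol_mem:
  assumes \<Phi>: "young_function \<Phi>"
  shows "(\<lambda>x::'a::euclidean_space. young_inverse \<Phi> (1 / ball_vol x)) \<in> weak_orlicz \<Phi>"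
    (is "?f \<in> _")
proof -
  have "(ball_vol :: 'a \<Rightarrow> real) \<in> borel_measurable borel"
    unfolding ball_vol_def by measurable
  \<comment> \<open>The generalized inverse is monotone and hence Borel.\<close>
  then have "?f \<in> borel_measurable borel"
    using borel_measurable_mono[OF young_inverse_mono[OF \<Phi>]] by measurable
  then have meas: "?f \<in> borel_measurable lebesgue"
    by (intro measurable_completion) (simp add: measurable_lborel1)
  have "weak_orlicz_norm \<Phi> ?f \<le> ennreal 1"
  proof (rule weak_orlicz_norm_le)
    fix t :: real assume t: "0 < t"
    show "ennreal (\<Phi> t) * emeasure lebesgue {x::'a. t < \<bar>?f x\<bar> / 1} \<le> 1"
    proof (cases "\<Phi> t = 0")
      case False
      then have pos: "0 < \<Phi> t"
        using young_nonneg[OF \<Phi>, of t] t by simp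
      have "ball_vol x \<le> 1 / \<Phi> t" if "t < ?f x" for x :: 'a
      proof -
        have "\<Phi> t \<le> 1 / ball_vol x"
          using that young_inverse_le[of t "1 / ball_vol x" \<Phi>] t by linarith
        \<comment> \<open>Where \<open>ball_vol x = 0\<close> the claim is trivial; elsewhere the
          reciprocals are inverted.\<close>
        then show ?thesis
          using pos ball_vol_nonneg[of x] by (cases "ball_vol x = 0") (auto simp: field_simps)
      qed
      then have "{x::'a. t < \<bar>?f x\<bar> / 1} \<subseteq> {x. ball_vol x \<le> 1 / \<Phi> t}"
        using young_inverse_nonneg[OF \<Phi>] by auto
      then have "emeasure lebesgue {x::'a. t < \<bar>?f x\<bar> / 1}
          \<le> emeasure lebesgue {x::'a. ball_vol x \<le> 1 / \<Phi> t}"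
        using pos by (intro emeasure_mono emeasure_ball_vol_le(1)) auto
      also have "\<dots> = ennreal (1 / \<Phi> t)"
        using pos by (intro emeasure_ball_vol_le(2)) simp
      finally show ?thesis
        using ennreal_mult_le_1_iff[OF pos] by simp
    qed simp
  qed simp
  then have "weak_orlicz_norm \<Phi> ?f < top"
    using le_less_trans by fastforce
  with meas show ?thesis by (simp add: weak_orlicz_def)
qed

text \<open>Away from the origin, the product \<open>G (1 / ball_vol x)\<close> does not increase
  with \<open>norm x\<close>, so its superlevel sets contain whole punctured balls. Comparing the
  volume \<open>1 / u\<close> of such a ball with the weak-type bound gives the inequality at
  \<open>u\<close>, with any \<open>b\<close> above the norm as constant.\<close>

lemma inverse_le_of_prod_mem:
  assumes \<Phi>: "young_function \<Phi>" and \<Phi>s: "\<And>i. i \<in> I \<Longrightarrow> young_function (\<Phi>s i)"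
    and mem: "(\<lambda>x::'a::euclidean_space. \<Prod>i\<in>I. young_inverse (\<Phi>s i) (1 / ball_vol x))
      \<in> weak_orlicz \<Phi>"
  shows "\<exists>C>0. \<forall>t\<ge>0. (\<Prod>i\<in>I. young_inverse (\<Phi>s i) t) \<le> C * young_inverse \<Phi> t"
proof -
  define G where "G u = (\<Prod>i\<in>I. young_inverse (\<Phi>s i) u)" for u
  have G_nonneg: "0 \<le> G u" for u
    unfolding G_def by (intro prod_nonneg young_inverse_nonneg \<Phi>s)
  have G_mono: "G u \<le> G v" if "u \<le> v" for u v
    unfolding G_def using that \<Phi>s
    by (intro prod_mono conjI young_inverse_nonneg monoD[OF young_inverse_mono])
  have meas: "(\<lambda>x::'a. G (1 / ball_vol x)) \<in> borel_measurable lebesgue"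
    and fin: "weak_orlicz_norm \<Phi> (\<lambda>x::'a. G (1 / ball_vol x)) < top"
    using mem by (auto simp: weak_orlicz_def G_def)
  obtain b where b: "weak_orlicz_norm \<Phi> (\<lambda>x::'a. G (1 / ball_vol x)) < ennreal b"
  proof -
    obtain c where c: "0 \<le> c" "weak_orlicz_norm \<Phi> (\<lambda>x::'a. G (1 / ball_vol x)) = ennreal c"
      using fin by (cases "weak_orlicz_norm \<Phi> (\<lambda>x::'a. G (1 / ball_vol x))") auto
    then show ?thesis using that[of "c + 1"] by (simp add: ennreal_less_iff)
  qed
  \<comment> \<open>\<open>ennreal\<close> sends nonpositive reals to 0, and no norm lies strictly
    below 0.\<close>
  then have b0: "0 < b"
    by (cases "0 < b") (auto simp: ennreal_neg)
  have pos_case: "G u \<le> b * young_inverse \<Phi> u" if u: "0 < u" for u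
  proof (rule ccontr)
    assume "\<not> G u \<le> b * young_inverse \<Phi> u"
    then have "young_inverse \<Phi> u < G u / b"
      using b0 by (simp add: field_simps)
    \<comment> \<open>The lower bound on \<open>t\<close> yields \<open>u < \<Phi> t\<close>; the
      upper bound puts the punctured ball of volume \<open>1 / u\<close> inside the superlevel set
      \<open>A\<close>. The two facts are incompatible.\<close>
    then obtain t where t: "young_inverse \<Phi> u < t" "t < G u / b"
      using dense by blast
    then have t0: "0 < t"
      using young_inverse_nonneg[OF \<Phi>, of u] by simp
    have ut: "u < \<Phi> t" by (rule young_inverse_less[OF \<Phi> t(1)])
    define A where "A = {x::'a. t < \<bar>G (1 / ball_vol x)\<bar> / b}"
    have A: "A \<in> sets lebesgue"
      unfolding A_def by (rule sets_lebesgue_abs_greater[OF meas])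
    \<comment> \<open>The origin is removed because division by zero gives
      \<open>1 / ball_vol 0 = 0\<close>, so the function takes the value \<open>G 0\<close> there,
      which may be small. A single point is a null set.\<close>
    have sub: "{x::'a. ball_vol x \<le> 1 / u} - {0} \<subseteq> A"
    proof
      fix x :: 'a assume x: "x \<in> {x. ball_vol x \<le> 1 / u} - {0}"
      then have "0 < ball_vol x" by (simp add: ball_vol_def)
      then have "u \<le> 1 / ball_vol x" using x u by (simp add: field_simps)
      then have "G u / b \<le> G (1 / ball_vol x) / b"
        using b0 by (intro divide_right_mono G_mono) auto
      then show "x \<in> A" using t(2) G_nonneg by (simp add: A_def)
    qed
    have null: "{0::'a} \<in> null_sets lebesgue"
      by (simp add: null_sets_def)
    have "ennreal (1 / u) = emeasure lebesgue {x::'a. ball_vol x \<le> 1 / u}"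
      using u by (simp add: emeasure_ball_vol_le(2))
    also have "\<dots> = emeasure lebesgue ({x::'a. ball_vol x \<le> 1 / u} - {0})"
      using u by (intro emeasure_Diff_null_set[OF null, symmetric] emeasure_ball_vol_le(1)) simp
    also have "\<dots> \<le> emeasure lebesgue A"
      using sub A by (rule emeasure_mono)
    also have "\<dots> \<le> ennreal (1 / \<Phi> t)"
      using weak_orlicz_norm_less[OF meas b t0] ennreal_mult_le_1_iff[of "\<Phi> t"] u ut
      by (simp add: A_def)
    finally have "1 / u \<le> 1 / \<Phi> t"
      using u ut by simp
    then show False using u ut by (simp add: field_simps)
  qed
  have "G u \<le> b * young_inverse \<Phi> u" if "0 \<le> u" for u
  proof (cases "u = 0")
    case True
    \<comment> \<open>No ball of finite volume corresponds to \<open>u = 0\<close>. Instead, for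
      each \<open>r\<close> with \<open>\<Phi> r > 0\<close> the positive case is used at
      \<open>\<Phi> r / 2\<close>; halving gives the strict inequality that makes \<open>r\<close> a
      competitor for the inverse at that level.\<close>
    have "G 0 / b \<le> young_inverse \<Phi> 0"
    proof (rule young_inverse_greatest[OF \<Phi>])
      fix r assume r: "0 \<le> r" "0 < \<Phi> r"
      have "G 0 \<le> G (\<Phi> r / 2)" using r by (intro G_mono) simp
      also have "\<dots> \<le> b * young_inverse \<Phi> (\<Phi> r / 2)" using r by (intro pos_case) simp
      also have "\<dots> \<le> b * r"
        using r b0 by (intro mult_left_mono young_inverse_le) auto
      finally show "G 0 / b \<le> r" using b0 by (simp add: field_simps)
    qed
    then show ?thesis using True b0 by (simp add: field_simps)
  qed (use that pos_case in auto)
  then show ?thesis using b0 by (auto simp: G_def)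
qed

section \<open>Equivalence of the four statements\<close>

theorem theorem2p6:
  fixes m :: nat
    and \<Phi> :: "real \<Rightarrow> real"
    and \<Phi>s :: "nat \<Rightarrow> real \<Rightarrow> real"
  assumes "2 \<le> m"
    and "young_function \<Phi>"
    and "\<And>i. i \<in> {1..m} \<Longrightarrow> young_function (\<Phi>s i)"
  shows
    "let
       S1 = (\<exists>C>0. \<forall>t\<ge>0. (\<Prod>i=1..m. young_inverse (\<Phi>s i) t) \<le> C * young_inverse \<Phi> t);
       S2 = (\<exists>C>0. \<forall>t :: nat \<Rightarrow> real. (\<forall>i\<in>{1..m}. 0 \<le> t i) \<longrightarrow>
               \<Phi> ((\<Prod>i=1..m. t i) / C) \<le> (\<Sum>i=1..m. \<Phi>s i (t i)));
       S3 = (\<exists>M>0. \<forall>f :: nat \<Rightarrow> real ^ 'n \<Rightarrow> real. (\<forall>i\<in>{1..m}. f i \<in> weak_orlicz (\<Phi>s i)) \<longrightarrow>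
               weak_orlicz_norm \<Phi> (\<lambda>x. \<Prod>i=1..m. f i x)
                 \<le> ennreal M * (\<Prod>i=1..m. weak_orlicz_norm (\<Phi>s i) (f i)));
       S4 = (\<forall>f :: nat \<Rightarrow> real ^ 'n \<Rightarrow> real. (\<forall>i\<in>{1..m}. f i \<in> weak_orlicz (\<Phi>s i)) \<longrightarrow>
               (\<lambda>x. \<Prod>i=1..m. f i x) \<in> weak_orlicz \<Phi>)
     in (S1 \<longleftrightarrow> S2) \<and> (S2 \<longleftrightarrow> S3) \<and> (S3 \<longleftrightarrow> S4)"
proof -
  let ?I = "{1..m}"
  define S1 where "S1 \<longleftrightarrow>
    (\<exists>C>0. \<forall>t\<ge>0. (\<Prod>i=1..m. young_inverse (\<Phi>s i) t) \<le> C * young_inverse \<Phi> t)"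
  define S2 where "S2 \<longleftrightarrow> (\<exists>C>0. \<forall>t :: nat \<Rightarrow> real. (\<forall>i\<in>{1..m}. 0 \<le> t i) \<longrightarrow>
    \<Phi> ((\<Prod>i=1..m. t i) / C) \<le> (\<Sum>i=1..m. \<Phi>s i (t i)))"
  define S3 where "S3 \<longleftrightarrow> (\<exists>M>0. \<forall>f :: nat \<Rightarrow> real ^ 'n \<Rightarrow> real.
    (\<forall>i\<in>{1..m}. f i \<in> weak_orlicz (\<Phi>s i)) \<longrightarrow>
      weak_orlicz_norm \<Phi> (\<lambda>x. \<Prod>i=1..m. f i x)
        \<le> ennreal M * (\<Prod>i=1..m. weak_orlicz_norm (\<Phi>s i) (f i)))"
  define S4 where "S4 \<longleftrightarrow> (\<forall>f :: nat \<Rightarrow> real ^ 'n \<Rightarrow> real.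
    (\<forall>i\<in>{1..m}. f i \<in> weak_orlicz (\<Phi>s i)) \<longrightarrow> (\<lambda>x. \<Prod>i=1..m. f i x) \<in> weak_orlicz \<Phi>)"
  have I: "finite ?I" "?I \<noteq> {}" using assms(1) by auto
  note \<Phi> = assms(2) and \<Phi>s = assms(3)
  have 12: "S2" if S1
  proof -
    obtain C where C: "0 < C" and le: "\<And>t. 0 \<le> t \<Longrightarrow>
        (\<Prod>i=1..m. young_inverse (\<Phi>s i) t) \<le> C * young_inverse \<Phi> t"
      using \<open>S1\<close> unfolding S1_def by blast
    have "\<Phi> ((\<Prod>i=1..m. t i) / C) \<le> (\<Sum>i=1..m. \<Phi>s i (t i))"
      if "\<forall>i\<in>?I. 0 \<le> t i" for t
      using young_inequality_of_inverse[OF \<Phi> \<Phi>s I(1) C le] that by simp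
    with C show S2 unfolding S2_def by (intro exI[of _ C]) simp
  qed
  have 21: "S1" if S2
  proof -
    obtain C where C: "0 < C" and le: "\<And>t. (\<And>i. i \<in> ?I \<Longrightarrow> 0 \<le> t i) \<Longrightarrow>
        \<Phi> ((\<Prod>i=1..m. t i) / C) \<le> (\<Sum>i=1..m. \<Phi>s i (t i))"
      using \<open>S2\<close> unfolding S2_def by auto
    have "0 < C * card ?I" using C assms(1) by simp
    then show S1
      unfolding S1_def using inverse_of_young_inequality[OF \<Phi> \<Phi>s I C le]
      by (intro exI[of _ "C * card ?I"] conjI allI impI) simp_all
  qed
  have 13: "S3" if S1
  proof -
    obtain C where C: "0 < C" and le: "\<And>t. 0 \<le> t \<Longrightarrow>
        (\<Prod>i=1..m. young_inverse (\<Phi>s i) t) \<le> C * young_inverse \<Phi> t"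
      using \<open>S1\<close> unfolding S1_def by blast
    have "0 < 2 ^ card ?I * C * card ?I" using C assms(1) by simp
    moreover have "weak_orlicz_norm \<Phi> (\<lambda>x. \<Prod>i=1..m. f i x)
        \<le> ennreal (2 ^ card ?I * C * card ?I) * (\<Prod>i=1..m. weak_orlicz_norm (\<Phi>s i) (f i))"
      if "\<forall>i\<in>?I. f i \<in> weak_orlicz (\<Phi>s i)" for f :: "nat \<Rightarrow> real ^ 'n \<Rightarrow> real"
      by (rule weak_orlicz_norm_prod_le[OF \<Phi> \<Phi>s I C le]) (use that in auto)
    ultimately show S3
      unfolding S3_def by (intro exI[of _ "2 ^ card ?I * C * card ?I"] conjI allI impI)
  qed
  have 34: "S4" if S3
    unfolding S4_def
  proof (intro allI impI)
    fix f :: "nat \<Rightarrow> real ^ 'n \<Rightarrow> real"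
    assume f: "\<forall>i\<in>?I. f i \<in> weak_orlicz (\<Phi>s i)"
    obtain M where "weak_orlicz_norm \<Phi> (\<lambda>x. \<Prod>i=1..m. f i x)
        \<le> ennreal M * (\<Prod>i=1..m. weak_orlicz_norm (\<Phi>s i) (f i))"
      using \<open>S3\<close> f unfolding S3_def by auto
    then show "(\<lambda>x. \<Prod>i=1..m. f i x) \<in> weak_orlicz \<Phi>"
      by (rule prod_mem_weak_orlicz[rotated]) (use f in auto)
  qed
  have 41: "S1" if S4
  proof -
    \<comment> \<open>One tuple of extremal functions suffices to test \<open>S4\<close>.\<close>
    have "(\<lambda>x::real^'n. \<Prod>i=1..m. young_inverse (\<Phi>s i) (1 / ball_vol x)) \<in> weak_orlicz \<Phi>"
    proof (rule \<open>S4\<close>[unfolded S4_def, rule_format])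
      fix i assume "i \<in> ?I"
      then show "(\<lambda>x::real^'n. young_inverse (\<Phi>s i) (1 / ball_vol x)) \<in> weak_orlicz (\<Phi>s i)"
        by (rule young_inverse_ball_vol_mem[OF \<Phi>s])
    qed
    then show S1
      unfolding S1_def by (rule inverse_le_of_prod_mem[OF \<Phi> \<Phi>s, rotated])
  qed
  \<comment> \<open>The cycle from \<open>S1\<close> through \<open>S3\<close> and \<open>S4\<close>
    back to \<open>S1\<close>, joined to the equivalence of \<open>S1\<close> and \<open>S2\<close>,
    connects all four statements.\<close>
  have "(S1 \<longleftrightarrow> S2) \<and> (S2 \<longleftrightarrow> S3) \<and> (S3 \<longleftrightarrow> S4)"
    using 12 21 13 34 41 by blast
  then show ?thesis
    unfolding Let_def S1_def S2_def S3_def S4_def .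
qed

end
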